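(* Let $G$ be a (possibly infinite) simple bipartite graph with bipartition $\{V_1,V_2\}$ and let $k$ be a positive integer. Then $G$ has a $1$-factor cover with at most $k$ $1$-factors if and only if (i) $\deg_G(x)\le k$ for each $x\in V(G)$; and (ii) $k\bigl(|N_G(T)|-|T|\bigr)\ \ge\ \sum_{x\in N_G(T)}\deg_G(x)-\sum_{x\in T}\deg_G(x)$ for each finite subset $T$ of $V_1$ or of $V_2$.
   Context: A graph has a (possibly infinite) vertex set and edge set consisting of $2$-element subsets of the vertex set. $N_G(x)$ is the set of neighbours of $x$, $\deg_G(x)=|N_G(x)|$, and $N_G(T)=\bigcup_{x\in T}N_G(x)$. A $1$-factor of $G$ is a set $F$ of edges such that every vertex is incident with exactly one edge of $F$. A $1$-factor cover of $G$ is a set $\mathcal{F}$ of $1$-factors of $G$ such that every edge of $G$ lies in at least one member of $\mathcal{F}$.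
   Formalization: The 1-factor cover is required to be nonempty; otherwise the empty set covers an edgeless graph with at least one vertex, where (i) holds but (ii) fails for a single vertex T={x}, and the equivalence would be false. *)

theory Defs
  imports Main
begin

definition simple_graph :: "'a set \<Rightarrow> 'a set set \<Rightarrow> bool" where
  "simple_graph V E \<longleftrightarrow> (\<forall>e\<in>E. e \<subseteq> V \<and> card e = 2)"

definition bipartition :: "'a set \<Rightarrow> 'a set set \<Rightarrow> 'a set \<Rightarrow> 'a set \<Rightarrow> bool" where
  "bipartition V E V1 V2 \<longleftrightarrow>
     V1 \<union> V2 = V \<and> V1 \<inter> V2 = {} \<and> (\<forall>e\<in>E. \<exists>x\<in>V1. \<exists>y\<in>V2. e = {x, y})"

definition neighbours :: "'a set set \<Rightarrow> 'a \<Rightarrow> 'a set" where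
  "neighbours E x = {y. {x, y} \<in> E}"

text \<open>Since \<^const>\<open>card\<close> is 0 on infinite sets, \<open>degree\<close> is the degree of \<open>x\<close> only
  when \<open>neighbours E x\<close> is finite; a bound on the degree of a vertex therefore has to be stated
  together with that finiteness.\<close>
definition degree :: "'a set set \<Rightarrow> 'a \<Rightarrow> nat" where
  "degree E x = card (neighbours E x)"

definition neighbourhood :: "'a set set \<Rightarrow> 'a set \<Rightarrow> 'a set" where
  "neighbourhood E T = (\<Union>x\<in>T. neighbours E x)"

definition one_factor :: "'a set \<Rightarrow> 'a set set \<Rightarrow> 'a set set \<Rightarrow> bool" where
  "one_factor V E F \<longleftrightarrow> F \<subseteq> E \<and> (\<forall>x\<in>V. \<exists>!e. e \<in> F \<and> x \<in> e)"

text \<open>The empty set satisfies this vacuously for an edgeless graph, even if that graph has vertices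
  and hence no 1-factor.\<close>
definition one_factor_cover :: "'a set \<Rightarrow> 'a set set \<Rightarrow> 'a set set set \<Rightarrow> bool" where
  "one_factor_cover V E \<F> \<longleftrightarrow> (\<forall>F\<in>\<F>. one_factor V E F) \<and> (\<forall>e\<in>E. \<exists>F\<in>\<F>. e \<in> F)"

end

theory Submission
  imports Defs
begin

text \<open>A cover by \<open>k\<close> 1-factors amounts to edge multiplicities that are at least 1 and sum to
  \<open>k\<close> around every vertex. Subtracting 1 from each multiplicity leaves nonnegative weights with
  sum \<open>d x = k - deg x\<close> around \<open>x\<close>, and condition (ii) says
  \<open>\<Sum>x\<in>T. d x \<le> \<Sum>x\<in>N(T). d x\<close>. This is Hall's condition for the graph in which each \<open>x\<close> is
  replaced by \<open>d x\<close> copies; a perfect matching there gives the weights. A \<open>k\<close>-regular weighted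
  bipartite graph again satisfies Hall's condition, so perfect matchings can be split off one at a
  time.\<close>

section \<open>Hall's theorem for locally finite relations, one-sided and two-sided\<close>

text \<open>Rado's proof: by Zorn's lemma there is a minimal subrelation satisfying Hall's condition (local
  finiteness makes the condition pass to intersections of chains), and submodularity of
  \<open>T \<mapsto> card (Q `` T)\<close> forces a minimal one to be single-valued.\<close>

lemma hall_locally_finite:
  fixes R :: "('a \<times> 'b) set"
  assumes fin: "\<And>a. a \<in> A \<Longrightarrow> finite (R `` {a})"
    and hall: "\<And>T. finite T \<Longrightarrow> T \<subseteq> A \<Longrightarrow> card T \<le> card (R `` T)"
  obtains f where "inj_on f A" and "\<And>a. a \<in> A \<Longrightarrow> (a, f a) \<in> R"
proof -
  \<comment> \<open>\<open>X\<close> collects deleted pairs, so a minimal subrelation with Hall's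
    condition is a maximal \<open>X\<close>, and Zorn's lemma is applied to unions of
    chains.\<close>
  define H where "H X \<longleftrightarrow> (\<forall>T. finite T \<and> T \<subseteq> A \<longrightarrow> card T \<le> card ((R - X) `` T))" for X
  have finT: "finite ((R - X) `` T)" if "finite T" "T \<subseteq> A" for X T
  proof -
    have "(R - X) `` T \<subseteq> (\<Union>a\<in>T. R `` {a})" by auto
    moreover have "finite (\<Union>a\<in>T. R `` {a})" using that fin by auto
    ultimately show ?thesis by (rule finite_subset)
  qed
  have "\<exists>M\<in>Collect H. \<forall>X\<in>Collect H. M \<subseteq> X \<longrightarrow> X = M"
  proof (rule subset_Zorn')
    fix C assume "subset.chain (Collect H) C"
    then have CH: "C \<subseteq> Collect H" and ch: "subset.chain C C"
      by (auto simp: subset_chain_def)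
    have "card T \<le> card ((R - \<Union>C) `` T)" if T: "finite T" "T \<subseteq> A" for T
    proof (cases "C = {}")
      case True
      then show ?thesis using hall T by simp
    next
      case False
      \<comment> \<open>Only finitely many pairs of \<open>R\<close> start in \<open>T\<close>, so
        one member of the chain already contains all of them that \<open>\<Union>C\<close>
        deletes.\<close>
      have "R \<inter> (T \<times> UNIV) = (SIGMA a:T. R `` {a})" by auto
      then have "finite (R \<inter> (T \<times> UNIV))" using T fin by auto
      then have "finite (R \<inter> (T \<times> UNIV) \<inter> \<Union>C)" by simp
      then obtain X where X: "X \<in> C" "R \<inter> (T \<times> UNIV) \<inter> \<Union>C \<subseteq> X"
        using finite_subset_Union_chain[OF _ _ False ch] by (metis Int_lower2)
      then have "(R - \<Union>C) `` T = (R - X) `` T" by blast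
      with X(1) CH T show ?thesis by (auto simp: H_def)
    qed
    then show "\<Union>C \<in> Collect H" by (simp add: H_def)
  qed
  then obtain M where M: "H M" and max: "\<And>X. H X \<Longrightarrow> M \<subseteq> X \<Longrightarrow> X = M" by blast
  define Q where "Q = R - M"
  have hQ: "card T \<le> card (Q `` T)" if "finite T" "T \<subseteq> A" for T
    using M that by (auto simp: H_def Q_def)
  have finQ: "finite (Q `` T)" if "finite T" "T \<subseteq> A" for T
    using finT that by (auto simp: Q_def)
  \<comment> \<open>By maximality, deleting \<open>(a, x)\<close> as well violates Hall's condition
    on some \<open>T\<close>, and \<open>a \<in> T\<close> because \<open>Q\<close> itself satisfies
    it. For \<open>I = T - {a}\<close> the strict inequality becomes a bound by
    \<open>card I\<close>.\<close>
  have tight: "\<exists>I. finite I \<and> I \<subseteq> A - {a} \<and> card (Q `` I \<union> (Q `` {a} - {x})) \<le> card I"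
    if "a \<in> A" "(a, x) \<in> Q" for a x
  proof -
    have "\<not> H (insert (a, x) M)"
    proof
      assume "H (insert (a, x) M)"
      then have "insert (a, x) M = M" by (rule max) auto
      then show False using that by (auto simp: Q_def)
    qed
    then obtain T where T: "finite T" "T \<subseteq> A" "card ((R - insert (a, x) M) `` T) < card T"
      unfolding H_def by (meson not_le)
    have a: "a \<in> T"
    proof (rule ccontr)
      assume "a \<notin> T"
      then have "(R - insert (a, x) M) `` T = Q `` T" by (auto simp: Q_def)
      then show False using hQ[OF T(1,2)] T(3) by simp
    qed
    have "Q `` (T - {a}) \<union> (Q `` {a} - {x}) = (R - insert (a, x) M) `` T"
      using a by (auto simp: Q_def)
    moreover have "card (T - {a}) = card T - 1" using a T by simp
    ultimately show ?thesis using T by (intro exI[of _ "T - {a}"]) auto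
  qed
  have single: "x = y" if a: "a \<in> A" and x: "(a, x) \<in> Q" and y: "(a, y) \<in> Q" for a x y
  proof (rule ccontr)
    assume ne: "x \<noteq> y"
    from tight[OF a x] obtain I where I: "finite I" "I \<subseteq> A - {a}"
      "card (Q `` I \<union> (Q `` {a} - {x})) \<le> card I" by blast
    from tight[OF a y] obtain J where J: "finite J" "J \<subseteq> A - {a}"
      "card (Q `` J \<union> (Q `` {a} - {y})) \<le> card J" by blast
    \<comment> \<open>As \<open>x \<noteq> y\<close>, the union of these sets is the whole image of
      \<open>insert a (I \<union> J)\<close>, and their intersection contains the image of
      \<open>I \<inter> J\<close>. Hall's bounds add up to \<open>card I + card J + 1\<close>, one
      more than tightness permits.\<close>
    let ?P = "Q `` I \<union> (Q `` {a} - {x})" and ?S = "Q `` J \<union> (Q `` {a} - {y})"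
    have fP: "finite ?P" and fS: "finite ?S"
      using finQ[of I] finQ[of J] finQ[of "{a}"] I J a by auto
    have "card (insert a (I \<union> J)) \<le> card (Q `` insert a (I \<union> J))"
      by (rule hQ) (use I J a in auto)
    also have "Q `` insert a (I \<union> J) = ?P \<union> ?S" using ne by auto
    finally have 1: "card (I \<union> J) + 1 \<le> card (?P \<union> ?S)"
      using I J by (subst (asm) card_insert_disjoint) auto
    have "card (I \<inter> J) \<le> card (Q `` (I \<inter> J))" by (rule hQ) (use I J in auto)
    also have "\<dots> \<le> card (?P \<inter> ?S)" by (rule card_mono) (use fP in auto)
    finally have "card (I \<inter> J) \<le> card (?P \<inter> ?S)" .
    with 1 I(3) J(3) card_Un_Int[OF fP fS] card_Un_Int[OF I(1) J(1)] show False by linarith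
  qed
  have "\<exists>b. (a, b) \<in> Q" if "a \<in> A" for a
    using hQ[of "{a}"] that by (cases "Q `` {a} = {}") auto
  then obtain f where f: "\<And>a. a \<in> A \<Longrightarrow> (a, f a) \<in> Q" by metis
  have "inj_on f A"
  proof (rule inj_onI, rule ccontr)
    fix a b assume ab: "a \<in> A" "b \<in> A" "f a = f b" "a \<noteq> b"
    have "Q `` {c} = {f c}" if "c \<in> A" for c using single[OF that] f[OF that] by blast
    then have "Q `` {a, b} = {f a}" using ab Image_Un[of Q "{a}" "{b}"] by (simp add: insert_commute)
    then show False using hQ[of "{a, b}"] ab by simp
  qed
  then show thesis using f that by (auto simp: Q_def)
qed

text \<open>The Schroeder--Bernstein construction stays inside \<^term>\<open>R\<close>.\<close>

lemma bij_betw_if_inj_both_ways: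
  assumes f: "inj_on f A" "\<And>a. a \<in> A \<Longrightarrow> f a \<in> B \<and> (a, f a) \<in> R"
    and g: "inj_on g B" "\<And>b. b \<in> B \<Longrightarrow> g b \<in> A \<and> (g b, b) \<in> R"
  obtains h where "bij_betw h A B" and "\<And>a. a \<in> A \<Longrightarrow> (a, h a) \<in> R"
proof -
  \<comment> \<open>The fixed-point equation makes \<open>g\<close> map the part of \<open>B\<close>
    not hit from \<open>X\<close> onto \<open>A - X\<close>, so \<open>h\<close> can use
    \<open>f\<close> on \<open>X\<close> and the inverse of \<open>g\<close> elsewhere.\<close>
  define X where "X = lfp (\<lambda>X. A - g ` (B - f ` X))"
  have X: "X = A - g ` (B - f ` X)"
    unfolding X_def by (rule lfp_unfold, rule monoI) blast
  define Y where "Y = B - f ` X"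
  have XA: "X \<subseteq> A" and AX: "A - X = g ` Y" using X g(2) by (auto simp: Y_def)
  have YB: "Y \<subseteq> B" by (auto simp: Y_def)
  have gY: "bij_betw g Y (A - X)"
    using AX inj_on_subset[OF g(1) YB] by (simp add: bij_betw_def)
  define h where "h a = (if a \<in> X then f a else inv_into Y g a)" for a
  have 1: "bij_betw h X (f ` X)"
    using inj_on_subset[OF f(1) XA] by (auto simp: bij_betw_def h_def inj_on_def)
  have "bij_betw (inv_into Y g) (A - X) Y" by (rule bij_betw_inv_into[OF gY])
  then have 2: "bij_betw h (A - X) Y"
    by (subst bij_betw_cong[where g = "inv_into Y g"]) (auto simp: h_def)
  have "bij_betw h (X \<union> (A - X)) (f ` X \<union> Y)"
    by (rule bij_betw_combine[OF 1 2]) (auto simp: Y_def)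
  moreover have "X \<union> (A - X) = A" "f ` X \<union> Y = B" using XA f(2) by (auto simp: Y_def)
  ultimately have "bij_betw h A B" by simp
  moreover have "(a, h a) \<in> R" if "a \<in> A" for a
  proof (cases "a \<in> X")
    case True then show ?thesis using f that by (simp add: h_def)
  next
    case False
    then have "a \<in> g ` Y" using AX that by auto
    then have "g (h a) = a" "h a \<in> Y"
      using False by (auto simp: h_def f_inv_into_f inv_into_into)
    then show ?thesis using g(2) YB by force
  qed
  ultimately show thesis using that by blast
qed

text \<open>Hall's condition on each side yields an injection along \<open>R\<close>, and the two
  merge into a bijection along \<open>R\<close>. On infinite sets a matching that saturates
  \<open>A\<close> may miss points of \<open>B\<close>, hence the condition for both sides.\<close>

lemma hall_two_sided:
  assumes R: "R \<subseteq> A \<times> B"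
    and fin: "\<And>a. a \<in> A \<Longrightarrow> finite (R `` {a})" "\<And>b. b \<in> B \<Longrightarrow> finite (R\<inverse> `` {b})"
    and hallA: "\<And>T. finite T \<Longrightarrow> T \<subseteq> A \<Longrightarrow> card T \<le> card (R `` T)"
    and hallB: "\<And>T. finite T \<Longrightarrow> T \<subseteq> B \<Longrightarrow> card T \<le> card (R\<inverse> `` T)"
  obtains h where "bij_betw h A B" and "\<And>a. a \<in> A \<Longrightarrow> (a, h a) \<in> R"
proof -
  obtain f where f: "inj_on f A" "\<And>a. a \<in> A \<Longrightarrow> (a, f a) \<in> R"
    using hall_locally_finite[of A R] fin(1) hallA by blast
  obtain g where g: "inj_on g B" "\<And>b. b \<in> B \<Longrightarrow> (b, g b) \<in> R\<inverse>"
    using hall_locally_finite[of B "R\<inverse>"] fin(2) hallB by blast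
  show thesis
    by (rule bij_betw_if_inj_both_ways[of f A B R g]) (use f g R that in blast)+
qed

section \<open>Weights with prescribed vertex sums\<close>

text \<open>A copy of \<open>a\<close> is joined to all \<open>q b\<close> copies of each neighbour
  \<open>b\<close>, so the image of \<open>S\<close> consists of full fibres. Enlarging
  \<open>S\<close> to full fibres over its projection leaves the image unchanged, so the weighted
  condition for the projection is enough.\<close>

lemma hall_blow_up:
  fixes R :: "('a \<times> 'b) set"
  assumes R: "R \<subseteq> A \<times> B"
    and fin: "\<And>a. a \<in> A \<Longrightarrow> finite (R `` {a})"
    and hall: "\<And>T. finite T \<Longrightarrow> T \<subseteq> A \<Longrightarrow> sum p T \<le> sum q (R `` T)"
    and S: "finite S" "S \<subseteq> (SIGMA a:A. {..<p a})"
  shows "finite ({((a, i), (b, j)). (a, b) \<in> R \<and> i < p a \<and> j < q b} `` S)"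
    and "card S \<le> card ({((a, i), (b, j)). (a, b) \<in> R \<and> i < p a \<and> j < (q b :: nat)} `` S)"
proof -
  let ?R = "{((a, i), (b, j)). (a, b) \<in> R \<and> i < p a \<and> j < q b}"
  let ?T = "fst ` S"
  have T: "finite ?T" "?T \<subseteq> A" using S by auto
  have "finite (\<Union>a\<in>?T. R `` {a})" using T fin by blast
  moreover have "R `` ?T = (\<Union>a\<in>?T. R `` {a})" by auto
  ultimately have fRT: "finite (R `` ?T)" by simp
  have eq: "?R `` S = (SIGMA b:R `` ?T. {..<q b})"
  proof
    show "?R `` S \<subseteq> (SIGMA b:R `` ?T. {..<q b})" by force
    show "(SIGMA b:R `` ?T. {..<q b}) \<subseteq> ?R `` S"
    proof
      fix t assume "t \<in> (SIGMA b:R `` ?T. {..<q b})"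
      then obtain b j a i where t: "t = (b, j)" "j < q b" "(a, b) \<in> R" "(a, i) \<in> S" by auto
      then have "((a, i), t) \<in> ?R" using S(2) by auto
      then show "t \<in> ?R `` S" using t(4) by (rule ImageI)
    qed
  qed
  then show "finite (?R `` S)" using fRT by auto
  have "S \<subseteq> (SIGMA a:?T. {..<p a})" using S(2) by force
  then have "card S \<le> card (SIGMA a:?T. {..<p a})"
    using T by (intro card_mono) auto
  also have "\<dots> = sum p ?T" using T by simp
  also have "\<dots> \<le> sum q (R `` ?T)" using T by (rule hall)
  also have "\<dots> = card (?R `` S)" using fRT eq by simp
  finally show "card S \<le> card (?R `` S)" .
qed

text \<open>A perfect matching between \<open>p a\<close> copies of each \<open>a\<close> and
  \<open>q b\<close> copies of each \<open>b\<close> gives the weights: \<open>w a b\<close> counts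
  the copies of \<open>a\<close> matched with copies of \<open>b\<close>.\<close>

lemma weights_exist:
  fixes R :: "('a \<times> 'b) set" and p :: "'a \<Rightarrow> nat" and q :: "'b \<Rightarrow> nat"
  assumes R: "R \<subseteq> A \<times> B"
    and fin: "\<And>a. a \<in> A \<Longrightarrow> finite (R `` {a})" "\<And>b. b \<in> B \<Longrightarrow> finite (R\<inverse> `` {b})"
    and hallA: "\<And>T. finite T \<Longrightarrow> T \<subseteq> A \<Longrightarrow> sum p T \<le> sum q (R `` T)"
    and hallB: "\<And>T. finite T \<Longrightarrow> T \<subseteq> B \<Longrightarrow> sum q T \<le> sum p (R\<inverse> `` T)"
  obtains w :: "'a \<Rightarrow> 'b \<Rightarrow> nat"
  where "\<And>a. a \<in> A \<Longrightarrow> (\<Sum>b\<in>R `` {a}. w a b) = p a"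
    and "\<And>b. b \<in> B \<Longrightarrow> (\<Sum>a\<in>R\<inverse> `` {b}. w a b) = q b"
proof -
  let ?A = "SIGMA a:A. {..<p a}" and ?B = "SIGMA b:B. {..<q b}"
  let ?R = "{((a, i), (b, j)). (a, b) \<in> R \<and> i < p a \<and> j < q b}"
  \<comment> \<open>The converse of the blown-up relation is the blow-up of the converse, so
    \<open>hall_blow_up\<close> serves both sides.\<close>
  have conv: "?R\<inverse> = {((b, j), (a, i)). (b, a) \<in> R\<inverse> \<and> j < q b \<and> i < p a}" by auto
  have R': "R\<inverse> \<subseteq> B \<times> A" using R by auto
  note bA = hall_blow_up[of R A B p q, OF R fin(1) hallA]
  note bB = hall_blow_up[of "R\<inverse>" B A q p, OF R' fin(2) hallB]
  obtain h where h: "bij_betw h ?A ?B" "\<And>s. s \<in> ?A \<Longrightarrow> (s, h s) \<in> ?R"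
  proof (rule hall_two_sided[of ?R ?A ?B])
    show "?R \<subseteq> ?A \<times> ?B" using R by auto
    show "finite (?R `` {s})" if "s \<in> ?A" for s by (rule bA(1)) (use that in auto)
    show "card T \<le> card (?R `` T)" if "finite T" "T \<subseteq> ?A" for T by (rule bA(2)) (use that in auto)
    show "finite (?R\<inverse> `` {s})" if "s \<in> ?B" for s
      unfolding conv by (rule bB(1)) (use that in auto)
    show "card T \<le> card (?R\<inverse> `` T)" if "finite T" "T \<subseteq> ?B" for T
      unfolding conv by (rule bB(2)) (use that in auto)
  qed (rule that)
  have hR: "(a, fst (h (a, i))) \<in> R" if "a \<in> A" "i < p a" for a i
    using h(2)[of "(a, i)"] that by (cases "h (a, i)") auto
  define w where "w a b = card {i. i < p a \<and> fst (h (a, i)) = b}" for a b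
  show thesis
  proof
    fix a assume a: "a \<in> A"
    have "(\<Sum>b\<in>R `` {a}. w a b) = card (\<Union>b\<in>R `` {a}. {i. i < p a \<and> fst (h (a, i)) = b})"
      unfolding w_def by (rule card_UN_disjoint[symmetric]) (use fin a in auto)
    also have "(\<Union>b\<in>R `` {a}. {i. i < p a \<and> fst (h (a, i)) = b}) = {..<p a}"
      using hR a by auto
    finally show "(\<Sum>b\<in>R `` {a}. w a b) = p a" by simp
  next
    fix b assume b: "b \<in> B"
    \<comment> \<open>These are the copies that \<open>h\<close> matches with copies of
      \<open>b\<close>. Their number is the column sum, and \<open>h\<close> maps them bijectively
      onto the \<open>q b\<close> copies of \<open>b\<close>.\<close>
    let ?S = "SIGMA a:R\<inverse> `` {b}. {i. i < p a \<and> fst (h (a, i)) = b}"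
    have SA: "?S \<subseteq> ?A" using R by auto
    have "(\<Sum>a\<in>R\<inverse> `` {b}. w a b) = card ?S"
      unfolding w_def using fin b by simp
    also have "\<dots> = card (h ` ?S)"
      using inj_on_subset[OF bij_betw_imp_inj_on[OF h(1)] SA] by (simp add: card_image)
    also have "h ` ?S = {b} \<times> {..<q b}"
    proof
      show "h ` ?S \<subseteq> {b} \<times> {..<q b}"
      proof
        fix t assume "t \<in> h ` ?S"
        then obtain a i where t: "t = h (a, i)" "i < p a" "fst (h (a, i)) = b" "(a, b) \<in> R"
          by auto
        then have "h (a, i) \<in> ?B" using h(1) R by (intro bij_betw_apply[OF h(1)]) auto
        then show "t \<in> {b} \<times> {..<q b}" using t by (cases "h (a, i)") auto
      qed
      show "{b} \<times> {..<q b} \<subseteq> h ` ?S"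
      proof
        fix t assume t: "t \<in> {b} \<times> {..<q b}"
        then have "t \<in> ?B" using b by auto
        then have "t \<in> h ` ?A" using h(1) by (simp add: bij_betw_def)
        then obtain a i where ai: "a \<in> A" "i < p a" "t = h (a, i)" by auto
        then have "(a, i) \<in> ?S" using hR[of a i] t by auto
        then show "t \<in> h ` ?S" using ai by blast
      qed
    qed
    finally show "(\<Sum>a\<in>R\<inverse> `` {b}. w a b) = q b" by simp
  qed
qed

section \<open>Splitting regular weights into perfect matchings\<close>

text \<open>Double counting: \<open>T\<close> sends out total weight \<open>card T * k\<close>, all
  of it into the positive-weight image, whose points receive at most \<open>k\<close> each.\<close>

lemma regular_weight_hall:
  fixes R :: "('a \<times> 'b) set" and w :: "'a \<Rightarrow> 'b \<Rightarrow> nat"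
  assumes R: "R \<subseteq> A \<times> B"
    and fin: "\<And>a. a \<in> A \<Longrightarrow> finite (R `` {a})" "\<And>b. b \<in> B \<Longrightarrow> finite (R\<inverse> `` {b})"
    and rows: "\<And>a. a \<in> A \<Longrightarrow> (\<Sum>b\<in>R `` {a}. w a b) = k"
    and cols: "\<And>b. b \<in> B \<Longrightarrow> (\<Sum>a\<in>R\<inverse> `` {b}. w a b) = k"
    and k: "k > 0" and T: "finite T" "T \<subseteq> A"
  shows "card T \<le> card ({(a, b) \<in> R. w a b > 0} `` T)"
proof -
  let ?N = "{(a, b) \<in> R. w a b > 0} `` T"
  have "R `` T = (\<Union>a\<in>T. R `` {a})" by auto
  then have "finite (R `` T)" using T fin by auto
  then have fN: "finite ?N" by (rule rev_finite_subset) auto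
  \<comment> \<open>Extending \<open>w\<close> by zero outside \<open>R\<close> lets both sums range
    over one rectangle, so that they can be swapped.\<close>
  define v where "v a b = (if (a, b) \<in> R then w a b else 0)" for a b
  have "card T * k = (\<Sum>a\<in>T. \<Sum>b\<in>R `` {a}. w a b)"
    using rows T by (simp add: subset_iff)
  also have "\<dots> = (\<Sum>a\<in>T. \<Sum>b\<in>?N. v a b)"
  proof (rule sum.cong[OF refl])
    fix a assume a: "a \<in> T"
    show "(\<Sum>b\<in>R `` {a}. w a b) = (\<Sum>b\<in>?N. v a b)"
      by (rule sum.mono_neutral_cong) (use a T fin fN in \<open>auto simp: v_def\<close>)
  qed
  also have "\<dots> = (\<Sum>b\<in>?N. \<Sum>a\<in>T. v a b)" by (rule sum.swap)
  also have "\<dots> \<le> (\<Sum>b\<in>?N. k)"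
  proof (rule sum_mono)
    fix b assume "b \<in> ?N"
    then have b: "b \<in> B" using R by auto
    have "(\<Sum>a\<in>T. v a b) = (\<Sum>a\<in>T \<inter> R\<inverse> `` {b}. w a b)"
      by (rule sum.mono_neutral_cong) (use T fin b in \<open>auto simp: v_def\<close>)
    also have "\<dots> \<le> (\<Sum>a\<in>R\<inverse> `` {b}. w a b)" by (rule sum_mono2) (use fin b in auto)
    finally show "(\<Sum>a\<in>T. v a b) \<le> k" using cols b by simp
  qed
  also have "\<dots> = card ?N * k" by simp
  finally show ?thesis using k by simp
qed

text \<open>Induction on the vertex sum: the pairs of positive weight contain a perfect matching by
  \<open>regular_weight_hall\<close>, and lowering the weights along it by 1 leaves regular weights
  with a sum smaller by 1.\<close>

lemma regular_weight_decomposition: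
  fixes R :: "('a \<times> 'b) set" and w :: "'a \<Rightarrow> 'b \<Rightarrow> nat"
  assumes R: "R \<subseteq> A \<times> B"
    and fin: "\<And>a. a \<in> A \<Longrightarrow> finite (R `` {a})" "\<And>b. b \<in> B \<Longrightarrow> finite (R\<inverse> `` {b})"
    and "\<And>a. a \<in> A \<Longrightarrow> (\<Sum>b\<in>R `` {a}. w a b) = k"
    and "\<And>b. b \<in> B \<Longrightarrow> (\<Sum>a\<in>R\<inverse> `` {b}. w a b) = k"
  shows "\<exists>f. (\<forall>i<k. bij_betw (f i) A B \<and> (\<forall>a\<in>A. (a, f i a) \<in> R)) \<and>
           (\<forall>a b. (a, b) \<in> R \<longrightarrow> w a b > 0 \<longrightarrow> (\<exists>i<k. f i a = b))"
  using assms(4,5)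
proof (induction k arbitrary: w)
  case 0
  \<comment> \<open>With vertex sums 0 all weights vanish, so no pair has to be covered and no
    matching has to be given.\<close>
  have "w a b = 0" if "(a, b) \<in> R" for a b
  proof -
    have "a \<in> A" using that R by auto
    then have "\<forall>b\<in>R `` {a}. w a b = 0" using 0(1)[of a] fin(1)[of a] by simp
    then show ?thesis using that by simp
  qed
  then show ?case by auto
next
  case (Suc k)
  let ?R = "{(a, b) \<in> R. w a b > 0}"
  have conv: "?R\<inverse> = {(b, a) \<in> R\<inverse>. w a b > 0}" by auto
  obtain h where h: "bij_betw h A B" "\<And>a. a \<in> A \<Longrightarrow> (a, h a) \<in> ?R"
  proof (rule hall_two_sided[of ?R A B])
    show "?R \<subseteq> A \<times> B" using R by auto
    show "finite (?R `` {a})" if "a \<in> A" for a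
      by (rule finite_subset[OF _ fin(1)[OF that]]) auto
    show "finite (?R\<inverse> `` {b})" if "b \<in> B" for b
      by (rule finite_subset[OF _ fin(2)[OF that]]) auto
    show "card T \<le> card (?R `` T)" if "finite T" "T \<subseteq> A" for T
      by (rule regular_weight_hall[OF R fin Suc.prems]) (use that in auto)
    show "card T \<le> card (?R\<inverse> `` T)" if "finite T" "T \<subseteq> B" for T
      unfolding conv
      by (rule regular_weight_hall[where R = "R\<inverse>" and A = B and B = A and k = "Suc k"])
        (use that R fin Suc.prems in auto)
  qed (rule that)
  \<comment> \<open>Truncated subtraction loses nothing for \<open>a \<in> A\<close>, since
    \<open>h\<close> picks pairs of positive weight.\<close>
  define v where "v a b = w a b - (if b = h a then 1 else 0)" for a b
  have wv: "w a b = v a b + (if b = h a then 1 else 0)" if "a \<in> A" for a b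
    using h(2)[OF that] by (auto simp: v_def)
  have "\<exists>f. (\<forall>i<k. bij_betw (f i) A B \<and> (\<forall>a\<in>A. (a, f i a) \<in> R)) \<and>
           (\<forall>a b. (a, b) \<in> R \<longrightarrow> v a b > 0 \<longrightarrow> (\<exists>i<k. f i a = b))"
  proof (rule Suc.IH)
    fix a assume a: "a \<in> A"
    have "Suc k = (\<Sum>b\<in>R `` {a}. v a b + (if b = h a then 1 else 0))"
      using Suc.prems(1)[OF a] wv[OF a] by simp
    also have "\<dots> = (\<Sum>b\<in>R `` {a}. v a b) + 1"
      using fin(1)[OF a] h(2)[OF a] by (simp add: sum.distrib)
    finally show "(\<Sum>b\<in>R `` {a}. v a b) = k" by simp
  next
    fix b assume b: "b \<in> B"
    \<comment> \<open>By bijectivity of \<open>h\<close>, the partner \<open>c\<close> of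
      \<open>b\<close> is the only place where the column of \<open>b\<close> is lowered.\<close>
    then obtain c where c: "c \<in> A" "h c = b" using h(1) by (auto simp: bij_betw_def)
    have sub: "R\<inverse> `` {b} \<subseteq> A" using R by auto
    have "Suc k = (\<Sum>a\<in>R\<inverse> `` {b}. w a b)" using Suc.prems(2)[OF b] by simp
    also have "\<dots> = (\<Sum>a\<in>R\<inverse> `` {b}. v a b + (if a = c then 1 else 0))"
    proof (rule sum.cong[OF refl])
      fix a assume "a \<in> R\<inverse> `` {b}"
      then have a: "a \<in> A" using sub by auto
      then have "b = h a \<longleftrightarrow> a = c" using c h(1) by (auto simp: bij_betw_def inj_on_def)
      then show "w a b = v a b + (if a = c then 1 else 0)" using wv[OF a] by simp
    qed
    also have "\<dots> = (\<Sum>a\<in>R\<inverse> `` {b}. v a b) + 1"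
      using fin(2)[OF b] h(2)[OF c(1)] c(2) by (simp add: sum.distrib)
    finally show "(\<Sum>a\<in>R\<inverse> `` {b}. v a b) = k" by simp
  qed
  then obtain f where f: "\<And>i. i < k \<Longrightarrow> bij_betw (f i) A B \<and> (\<forall>a\<in>A. (a, f i a) \<in> R)"
    and cov: "\<And>a b. (a, b) \<in> R \<Longrightarrow> v a b > 0 \<Longrightarrow> \<exists>i<k. f i a = b" by blast
  show ?case
  \<comment> \<open>A pair of positive weight is either matched by \<open>h\<close>, at index
    \<open>k\<close>, or keeps its weight in \<open>v\<close> and is covered by an earlier
    matching.\<close>
  proof (intro exI[of _ "f(k := h)"] conjI allI impI ballI)
    show "bij_betw ((f(k := h)) i) A B" if "i < Suc k" for i
      using that f h by (auto simp: less_Suc_eq)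
    show "(a, (f(k := h)) i a) \<in> R" if "i < Suc k" "a \<in> A" for i a
      using that f h(2) by (auto simp: less_Suc_eq)
    show "\<exists>i<Suc k. (f(k := h)) i a = b" if ab: "(a, b) \<in> R" "w a b > 0" for a b
    proof (cases "b = h a")
      case True then show ?thesis by (intro exI[of _ k]) simp
    next
      case False
      then have "v a b > 0" using ab by (simp add: v_def)
      then obtain i where "i < k" "f i a = b" using cov ab by blast
      then show ?thesis by (intro exI[of _ i]) simp
    qed
  qed
qed

section \<open>Necessity of the two conditions\<close>

lemma neighbours_sym: "y \<in> neighbours E x \<longleftrightarrow> x \<in> neighbours E y"
  by (simp add: neighbours_def insert_commute)

text \<open>Repeating one factor sufficiently often, assume that there are exactly \<open>k\<close> of them, and let
  \<open>m x y\<close> count those through the edge \<open>xy\<close>. Then \<open>m x y - 1\<close> is nonnegative and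
  sums to \<open>k - deg x\<close> around \<open>x\<close>; every edge at \<open>T\<close> is also an edge at its neighbourhood.\<close>

lemma one_factor_cover_necessary:
  assumes G: "simple_graph V E"
    and cover: "one_factor_cover V E \<F>" "\<F> \<noteq> {}" "finite \<F>" "card \<F> \<le> k"
  shows "\<And>x. x \<in> V \<Longrightarrow> finite (neighbours E x)"
    and "\<And>x. x \<in> V \<Longrightarrow> degree E x \<le> k"
    and "\<And>T. finite T \<Longrightarrow> T \<subseteq> V \<Longrightarrow>
      (\<Sum>x\<in>T. int k - int (degree E x)) \<le> (\<Sum>x\<in>neighbourhood E T. int k - int (degree E x))"
proof -
  have F: "one_factor V E F" if "F \<in> \<F>" for F using cover that by (simp add: one_factor_cover_def)
  have "\<exists>y. {z. {x, z} \<in> F} = {y}" if Fx: "F \<in> \<F>" "x \<in> V" for F x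
  proof -
    obtain e where e: "e \<in> F" "x \<in> e" "\<And>e'. e' \<in> F \<Longrightarrow> x \<in> e' \<Longrightarrow> e' = e"
      using F[OF Fx(1)] Fx(2) unfolding one_factor_def by metis
    have "card e = 2" using e(1) F[OF Fx(1)] G by (auto simp: one_factor_def simple_graph_def)
    then obtain y where y: "e = {x, y}" "y \<noteq> x"
      using e(2) by (auto simp: card_2_iff)
    have "{z. {x, z} \<in> F} = {y}"
    proof (intro set_eqI iffI)
      fix z assume "z \<in> {z. {x, z} \<in> F}"
      then have "{x, z} = {x, y}" using e(3)[of "{x, z}"] y by simp
      then show "z \<in> {y}" by (auto simp: doubleton_eq_iff)
    qed (use e(1) y in auto)
    then show ?thesis ..
  qed
  then obtain mate where mate: "\<And>F x. F \<in> \<F> \<Longrightarrow> x \<in> V \<Longrightarrow> {z. {x, z} \<in> F} = {mate F x}" by metis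
  \<comment> \<open>Since the factors cover \<open>E\<close>, the neighbours of \<open>x\<close> are
    exactly its partners in them; local finiteness and (i) follow at once.\<close>
  have nb: "neighbours E x = (\<lambda>F. mate F x) ` \<F>" if x: "x \<in> V" for x
  proof
    show "neighbours E x \<subseteq> (\<lambda>F. mate F x) ` \<F>"
    proof
      fix y assume "y \<in> neighbours E x"
      then obtain F where "F \<in> \<F>" "{x, y} \<in> F"
        using cover(1) by (auto simp: one_factor_cover_def neighbours_def)
      then show "y \<in> (\<lambda>F. mate F x) ` \<F>" using mate[of F x] x by auto
    qed
    show "(\<lambda>F. mate F x) ` \<F> \<subseteq> neighbours E x"
      using mate x F by (fastforce simp: neighbours_def one_factor_def)
  qed
  show finN: "finite (neighbours E x)" if "x \<in> V" for x using nb that cover by simp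
  show "degree E x \<le> k" if "x \<in> V" for x
    using nb[OF that] card_image_le[OF cover(3), of "\<lambda>F. mate F x"] cover(4) by (simp add: degree_def)
  obtain F0 where F0: "F0 \<in> \<F>" using cover by auto
  \<comment> \<open>\<open>F0\<close> absorbs the \<open>k - card \<F>\<close> missing repetitions,
    so that the total is exactly \<open>k\<close>.\<close>
  define c where "c F = 1 + (if F = F0 then k - card \<F> else 0)" for F
  have csum: "sum c \<F> = k"
    using F0 cover unfolding c_def sum.distrib by simp
  define m where "m x y = (\<Sum>F\<in>\<F>. if {x, y} \<in> F then c F else 0)" for x y
  have msym: "m x y = m y x" for x y by (simp add: m_def insert_commute)
  have m1: "1 \<le> m x y" if xy: "y \<in> neighbours E x" for x y
  proof -
    obtain F where F': "F \<in> \<F>" "{x, y} \<in> F"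
      using xy cover(1) by (auto simp: one_factor_cover_def neighbours_def)
    have "1 \<le> (if {x, y} \<in> F then c F else 0)" using F' by (simp add: c_def)
    also have "\<dots> \<le> m x y" unfolding m_def
      by (rule member_le_sum) (use F' cover in auto)
    finally show ?thesis .
  qed
  have msum: "(\<Sum>y\<in>neighbours E x. m x y) = k" if x: "x \<in> V" for x
  proof -
    have "(\<Sum>y\<in>neighbours E x. m x y)
        = (\<Sum>F\<in>\<F>. \<Sum>y\<in>neighbours E x. if {x, y} \<in> F then c F else 0)"
      unfolding m_def by (rule sum.swap)
    also have "\<dots> = (\<Sum>F\<in>\<F>. c F)"
    proof (rule sum.cong[OF refl])
      fix F assume F': "F \<in> \<F>"
      then have "{x, y} \<in> F \<longleftrightarrow> y = mate F x" for y using mate[OF F' x] by auto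
      moreover have "mate F x \<in> neighbours E x" using nb x F' by auto
      ultimately show "(\<Sum>y\<in>neighbours E x. if {x, y} \<in> F then c F else 0) = c F"
        using finN[OF x] by simp
    qed
    finally show ?thesis using csum by simp
  qed
  have exc: "(\<Sum>y\<in>neighbours E x. int (m x y) - 1) = int k - int (degree E x)" if "x \<in> V" for x
    using msum[OF that] by (simp add: sum_subtractf degree_def flip: of_nat_sum)
  fix T assume T: "finite T" "T \<subseteq> V"
  have NV: "neighbours E x \<subseteq> V" for x
    using G by (auto simp: neighbours_def simple_graph_def)
  let ?N = "neighbourhood E T"
  have N: "finite ?N" "?N \<subseteq> V" using T finN NV by (auto simp: neighbourhood_def)
  let ?P = "SIGMA x:T. neighbours E x" and ?Q = "SIGMA y:?N. neighbours E y"
  have "(\<Sum>x\<in>T. int k - int (degree E x)) = (\<Sum>x\<in>T. \<Sum>y\<in>neighbours E x. int (m x y) - 1)"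
    using exc T by (intro sum.cong) auto
  also have "\<dots> = (\<Sum>(x, y)\<in>?P. int (m x y) - 1)"
    using T finN by (intro sum.Sigma) auto
  \<comment> \<open>Each edge at \<open>T\<close> is now read from its other end, which lies in
    \<open>?N\<close>. The further pairs of \<open>?Q\<close> contribute nonnegatively because
    \<open>m\<close> is at least 1 on edges.\<close>
  also have "\<dots> = (\<Sum>(y, x)\<in>prod.swap ` ?P. int (m y x) - 1)"
    by (subst sum.reindex) (auto simp: msym case_prod_unfold)
  also have "\<dots> \<le> (\<Sum>(y, x)\<in>?Q. int (m y x) - 1)"
  proof (rule sum_mono2)
    show "finite ?Q" using N finN by auto
    show "prod.swap ` ?P \<subseteq> ?Q" using neighbours_sym[of _ E] by (fastforce simp: neighbourhood_def)
    show "0 \<le> (case p of (y, x) \<Rightarrow> int (m y x) - 1)" if "p \<in> ?Q - prod.swap ` ?P" for p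
      using that m1 by (auto simp: Suc_le_eq)
  qed
  also have "\<dots> = (\<Sum>y\<in>?N. \<Sum>x\<in>neighbours E y. int (m y x) - 1)"
    using N finN by (intro sum.Sigma[symmetric]) auto
  also have "\<dots> = (\<Sum>y\<in>?N. int k - int (degree E y))"
    using exc N by (intro sum.cong) auto
  finally show "(\<Sum>x\<in>T. int k - int (degree E x)) \<le> (\<Sum>x\<in>?N. int k - int (degree E x))" .
qed

section \<open>Sufficiency of the two conditions\<close>

lemma one_factor_of_bij:
  assumes G: "bipartition V E V1 V2"
    and f: "bij_betw f V1 V2" "\<And>a. a \<in> V1 \<Longrightarrow> {a, f a} \<in> E"
  shows "one_factor V E ((\<lambda>a. {a, f a}) ` V1)"
proof -
  have V: "V = V1 \<union> V2" "V1 \<inter> V2 = {}" using G by (auto simp: bipartition_def)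
  have fV: "f a \<in> V2" if "a \<in> V1" for a using f that by (auto simp: bij_betw_def)
  have "\<exists>!e. e \<in> (\<lambda>a. {a, f a}) ` V1 \<and> x \<in> e" if "x \<in> V" for x
  proof (cases "x \<in> V1")
    case True
    show ?thesis
      by (rule ex1I[of _ "{x, f x}"]) (use True V fV in auto)
  next
    case False
    then have "x \<in> V2" using V that by auto
    then obtain a where a: "a \<in> V1" "f a = x" using f by (auto simp: bij_betw_def)
    show ?thesis
      by (rule ex1I[of _ "{a, f a}"])
        (use False a f(1) in \<open>auto simp: bij_betw_def inj_on_def\<close>)
  qed
  then show ?thesis using f by (auto simp: one_factor_def)
qed

lemma one_factor_cover_sufficient:
  assumes G: "bipartition V E V1 V2"
    and k: "k > 0"
    and fin: "\<And>x. x \<in> V \<Longrightarrow> finite (neighbours E x)"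
    and deg: "\<And>x. x \<in> V \<Longrightarrow> degree E x \<le> k"
    and hall: "\<And>T. finite T \<Longrightarrow> T \<subseteq> V1 \<or> T \<subseteq> V2 \<Longrightarrow>
      (\<Sum>x\<in>T. int k - int (degree E x)) \<le> (\<Sum>x\<in>neighbourhood E T. int k - int (degree E x))"
  shows "\<exists>\<F>. one_factor_cover V E \<F> \<and> \<F> \<noteq> {} \<and> finite \<F> \<and> card \<F> \<le> k"
proof -
  have V: "V = V1 \<union> V2" "V1 \<inter> V2 = {}" using G by (auto simp: bipartition_def)
  have E: "\<exists>x\<in>V1. \<exists>y\<in>V2. e = {x, y}" if "e \<in> E" for e using G that by (auto simp: bipartition_def)
  have N1: "neighbours E a \<subseteq> V2" if "a \<in> V1" for a
  proof
    fix b assume "b \<in> neighbours E a"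
    then obtain x y where "x \<in> V1" "y \<in> V2" "{a, b} = {x, y}"
      using E[of "{a, b}"] by (auto simp: neighbours_def)
    then show "b \<in> V2" using that V by (auto simp: doubleton_eq_iff)
  qed
  have N2: "neighbours E b \<subseteq> V1" if "b \<in> V2" for b
  proof
    fix a assume "a \<in> neighbours E b"
    then obtain x y where "x \<in> V1" "y \<in> V2" "{b, a} = {x, y}"
      using E[of "{b, a}"] by (auto simp: neighbours_def)
    then show "a \<in> V1" using that V by (auto simp: doubleton_eq_iff)
  qed
  \<comment> \<open>Orienting the edges from \<open>V1\<close> to \<open>V2\<close> turns
    neighbourhoods on the two sides into images under \<open>R\<close> and its converse.\<close>
  define R where "R = {(a, b). a \<in> V1 \<and> b \<in> V2 \<and> {a, b} \<in> E}"
  have RV: "R \<subseteq> V1 \<times> V2" by (auto simp: R_def)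
  have R1: "R `` {a} = neighbours E a" if "a \<in> V1" for a
    using N1[OF that] that by (auto simp: R_def neighbours_def)
  have R2: "R\<inverse> `` {b} = neighbours E b" if "b \<in> V2" for b
    using N2[OF that] that by (auto simp: R_def neighbours_def insert_commute)
  have RT1: "R `` T = neighbourhood E T" if "T \<subseteq> V1" for T
    using R1 that by (fastforce simp: neighbourhood_def)
  have RT2: "R\<inverse> `` T = neighbourhood E T" if "T \<subseteq> V2" for T
    using R2 that by (fastforce simp: neighbourhood_def)
  have fin1: "finite (R `` {a})" if "a \<in> V1" for a using R1 fin V that by simp
  have fin2: "finite (R\<inverse> `` {b})" if "b \<in> V2" for b using R2 fin V that by simp
  let ?d = "\<lambda>x. k - degree E x"
  \<comment> \<open>By the degree bound the truncated difference is the true one, so (ii) becomes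
    the weighted Hall condition.\<close>
  have d: "int (sum ?d T) = (\<Sum>x\<in>T. int k - int (degree E x))" if "T \<subseteq> V" for T
    unfolding of_nat_sum using deg that by (intro sum.cong) (auto simp: of_nat_diff subset_iff)
  obtain w where w1: "\<And>a. a \<in> V1 \<Longrightarrow> (\<Sum>b\<in>R `` {a}. w a b) = ?d a"
    and w2: "\<And>b. b \<in> V2 \<Longrightarrow> (\<Sum>a\<in>R\<inverse> `` {b}. w a b) = ?d b"
  proof (rule weights_exist[OF RV fin1 fin2, of ?d ?d])
    fix T assume T: "finite T" "T \<subseteq> V1"
    have "int (sum ?d T) \<le> int (sum ?d (R `` T))"
    proof -
      have "T \<subseteq> V" "R `` T \<subseteq> V" using T RV V by auto
      then show ?thesis using hall[of T] T by (simp only: d RT1 simp_thms)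
    qed
    then show "sum ?d T \<le> sum ?d (R `` T)" by linarith
  next
    fix T assume T: "finite T" "T \<subseteq> V2"
    have "int (sum ?d T) \<le> int (sum ?d (R\<inverse> `` T))"
    proof -
      have "T \<subseteq> V" "R\<inverse> `` T \<subseteq> V" using T RV V by auto
      then show ?thesis using hall[of T] T by (simp only: d RT2 simp_thms)
    qed
    then show "sum ?d T \<le> sum ?d (R\<inverse> `` T)" by linarith
  qed blast+
  \<comment> \<open>Adding 1 back raises the vertex sums from \<open>k - degree E x\<close> to
    \<open>k\<close> and makes every edge positive, so the \<open>k\<close> matchings use every
    edge.\<close>
  have "\<exists>f. (\<forall>i<k. bij_betw (f i) V1 V2 \<and> (\<forall>a\<in>V1. (a, f i a) \<in> R)) \<and>
           (\<forall>a b. (a, b) \<in> R \<longrightarrow> w a b + 1 > 0 \<longrightarrow> (\<exists>i<k. f i a = b))"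
  proof (rule regular_weight_decomposition[OF RV fin1 fin2])
    show "(\<Sum>b\<in>R `` {a}. w a b + 1) = k" if "a \<in> V1" for a
    proof -
      have "(\<Sum>b\<in>R `` {a}. w a b + 1) = (k - degree E a) + degree E a"
        using w1[OF that] R1[OF that] by (simp add: sum.distrib degree_def del: One_nat_def)
      then show ?thesis using deg[of a] V that by simp
    qed
    show "(\<Sum>a\<in>R\<inverse> `` {b}. w a b + 1) = k" if "b \<in> V2" for b
    proof -
      have "(\<Sum>a\<in>R\<inverse> `` {b}. w a b + 1) = (k - degree E b) + degree E b"
        using w2[OF that] R2[OF that] by (simp add: sum.distrib degree_def del: One_nat_def)
      then show ?thesis using deg[of b] V that by simp
    qed
  qed
  then obtain f where f: "\<And>i. i < k \<Longrightarrow> bij_betw (f i) V1 V2"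
    "\<And>i a. i < k \<Longrightarrow> a \<in> V1 \<Longrightarrow> (a, f i a) \<in> R"
    and cov: "\<And>a b. (a, b) \<in> R \<Longrightarrow> w a b + 1 > 0 \<Longrightarrow> \<exists>i<k. f i a = b" by blast
  let ?F = "\<lambda>i. (\<lambda>a. {a, f i a}) ` V1"
  have "one_factor V E (?F i)" if "i < k" for i
    by (rule one_factor_of_bij[OF G f(1)[OF that]]) (use f(2)[OF that] in \<open>auto simp: R_def\<close>)
  moreover have "\<exists>i<k. e \<in> ?F i" if e: "e \<in> E" for e
  proof -
    obtain a b where ab: "a \<in> V1" "b \<in> V2" "e = {a, b}" using E[OF e] by blast
    then have "(a, b) \<in> R" using e by (simp add: R_def)
    then obtain i where "i < k" "f i a = b" using cov by auto
    then show ?thesis using ab by blast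
  qed
  ultimately have "one_factor_cover V E (?F ` {..<k})"
    unfolding one_factor_cover_def by (auto simp: Bex_def simp del: image_iff)
  \<comment> \<open>Different indices may give the same factor, hence only an upper bound.\<close>
  moreover have "card (?F ` {..<k}) \<le> k" using card_image_le[of "{..<k}" ?F] by simp
  ultimately show ?thesis using k by (intro exI[of _ "?F ` {..<k}"]) auto
qed

text \<open>Nonemptiness of \<open>\<F>\<close> excludes the vacuous cover of an edgeless graph with
  vertices, where (ii) fails at a single vertex. Finiteness accompanies the cardinality bounds
  because \<open>card\<close> is 0 on infinite sets.\<close>

theorem theorem1p2:
  fixes V V1 V2 :: "'a set" and E :: "'a set set" and k :: nat
  assumes "simple_graph V E"
    and "bipartition V E V1 V2"
    and "k > 0"
  shows "(\<exists>\<F>. one_factor_cover V E \<F> \<and> \<F> \<noteq> {} \<and> finite \<F> \<and> card \<F> \<le> k) \<longleftrightarrow>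
     (\<forall>x\<in>V. finite (neighbours E x) \<and> degree E x \<le> k) \<and>
     (\<forall>T. finite T \<and> (T \<subseteq> V1 \<or> T \<subseteq> V2) \<longrightarrow>
        int k * (int (card (neighbourhood E T)) - int (card T))
          \<ge> (\<Sum>x\<in>neighbourhood E T. int (degree E x)) - (\<Sum>x\<in>T. int (degree E x)))"
proof -
  have V: "V = V1 \<union> V2" using assms(2) by (simp add: bipartition_def)
  \<comment> \<open>Collecting \<open>k\<close> minus the degree at each vertex brings (ii) into the
    form used in both directions.\<close>
  have ii: "int k * (int (card N) - int (card T))
      \<ge> (\<Sum>x\<in>N. int (degree E x)) - (\<Sum>x\<in>T. int (degree E x)) \<longleftrightarrow>
    (\<Sum>x\<in>T. int k - int (degree E x)) \<le> (\<Sum>x\<in>N. int k - int (degree E x))" for N T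
    by (auto simp: sum_subtractf algebra_simps)
  show ?thesis
    unfolding ii
  proof (intro iffI, goal_cases)
    case 1
    then obtain \<F> where \<F>: "one_factor_cover V E \<F>" "\<F> \<noteq> {}" "finite \<F>" "card \<F> \<le> k" by blast
    show ?case using one_factor_cover_necessary[OF assms(1) \<F>] V by blast
  next
    case 2
    then show ?case by (intro one_factor_cover_sufficient[OF assms(2,3)]) blast+
  qed
qed

end
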